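(* For every positive integer $n$, (i) $p_n = \sum_{d\mid n}\mu\!\left(\frac{n}{d}\right)L_d$; (ii) $s_n = n\sum_{d\mid n}\mu\!\left(\frac{n}{d}\right)F_{\lfloor d/2\rfloor+2}$; (iii) $a_n = \sum_{d\mid n}\mu\!\left(\frac{n}{d}\right)\big(L_d - nF_{\lfloor d/2\rfloor+2}\big)$.
   Context: Strings are over $\{0,1\}$. For $u=u_1\cdots u_n$ define the cyclic shift $\alpha(u)=u_nu_1\cdots u_{n-1}$ and reversal $\beta(u)=u_n u_{n-1}\cdots u_1$; the orbit $\bar u$ of $u$ is its orbit under the group generated by $\alpha$ and $\beta$ (the dihedral group acting on $\{0,1\}^n$). A string $u$ is primitive if it is not of the form $v^k$ (concatenation of $k$ copies of a nonempty string $v$) with $k\ge 2$. A string $u$ of length $n$ is symmetric if $|\bar u|<2n$ and asymmetric if $|\bar u|=2n$. A Lucas string of length $n$ is a binary string $u_1\cdots u_n$ with no two consecutive 1s and not both $u_1=1$ and $u_n=1$. Let $p_n$ be the number of primitive Lucas strings of length $n$, $s_n$ the number of Lucas strings of length $n$ that are primitive and symmetric, and $a_n$ the number of asymmetric Lucas strings of length $n$. $F_m$ are Fibonacci numbers ($F_0=0,F_1=1$), $L_m$ Lucas numbers ($L_0=2,L_1=1$), $\mu$ the Möbius function, sums over positive divisors. *)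

theory Defs
  imports
    "HOL-Algebra.Group_Action"
    "HOL-Algebra.Generated_Groups"
    "HOL-Number_Theory.Fib"
    "HOL-Computational_Algebra.Primes"
    "HOL-Computational_Algebra.Squarefree"
begin

text \<open>Binary strings are lists of booleans, with \<^const>\<open>True\<close> for the symbol 1.\<close>

definition cyc_shift :: "bool list \<Rightarrow> bool list"
  where "cyc_shift u = (if u = [] then [] else last u # butlast u)"

abbreviation strings :: "nat \<Rightarrow> bool list set"
  where "strings n \<equiv> {u. length u = n}"

text \<open>
  Elements of \<^const>\<open>BijGroup\<close> are extensional functions, so the two generators have to be
  restricted to the strings of length \<open>n\<close>.
\<close>

definition dihedral :: "nat \<Rightarrow> (bool list \<Rightarrow> bool list) monoid"
  where "dihedral n =
    subgroup_generated (BijGroup (strings n)) {restrict cyc_shift (strings n), restrict rev (strings n)}"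

text \<open>
  \<^const>\<open>subgroup_generated\<close> silently drops generators outside the carrier of the ambient
  group; this does not happen here.
\<close>

lemma dihedral_generators_in_carrier:
  "{restrict cyc_shift (strings n), restrict rev (strings n)} \<subseteq> carrier (BijGroup (strings n))"
proof -
  have "bij_betw cyc_shift (strings n) (strings n)"
    by (rule bij_betw_byWitness[where f' = rotate1]) (auto simp: cyc_shift_def rotate1_hd_tl)
  moreover have "bij_betw rev (strings n) (strings n)"
    by (rule bij_betw_byWitness[where f' = rev]) auto
  ultimately show ?thesis
    by (simp add: BijGroup_def Bij_def)
qed

definition string_orbit :: "bool list \<Rightarrow> bool list set"
  where "string_orbit u = orbit (dihedral (length u)) (\<lambda>g. g) u"

definition primitive :: "bool list \<Rightarrow> bool"
  where "primitive u \<longleftrightarrow> \<not> (\<exists>v k. v \<noteq> [] \<and> k \<ge> 2 \<and> u = concat (replicate k v))"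

definition symmetric :: "bool list \<Rightarrow> bool"
  where "symmetric u \<longleftrightarrow> card (string_orbit u) < 2 * length u"

definition asymmetric :: "bool list \<Rightarrow> bool"
  where "asymmetric u \<longleftrightarrow> card (string_orbit u) = 2 * length u"

text \<open>For length 1 the last condition excludes the string 1, as its first and last symbol coincide.\<close>

definition lucas_string :: "bool list \<Rightarrow> bool"
  where "lucas_string u \<longleftrightarrow>
    \<not> (\<exists>i. Suc i < length u \<and> u ! i \<and> u ! Suc i) \<and> \<not> (u \<noteq> [] \<and> hd u \<and> last u)"

definition num_primitive :: "nat \<Rightarrow> nat"
  where "num_primitive n = card {u. length u = n \<and> lucas_string u \<and> primitive u}"

definition num_primitive_symmetric :: "nat \<Rightarrow> nat"
  where "num_primitive_symmetric n =
    card {u. length u = n \<and> lucas_string u \<and> primitive u \<and> symmetric u}"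

definition num_asymmetric :: "nat \<Rightarrow> nat"
  where "num_asymmetric n = card {u. length u = n \<and> lucas_string u \<and> asymmetric u}"

fun lucas_num :: "nat \<Rightarrow> nat"
  where
    "lucas_num 0 = 2"
  | "lucas_num (Suc 0) = 1"
  | "lucas_num (Suc (Suc n)) = lucas_num (Suc n) + lucas_num n"

definition moebius :: "nat \<Rightarrow> int"
  where "moebius n = (if squarefree n then (-1) ^ card (prime_factors n) else 0)"

end

theory Submission
  imports Defs
begin

text \<open>
  A string of length \<open>n\<close> is identified with an \<open>n\<close>-periodic function on the integers. It is
  primitive iff its least period is \<open>n\<close>, so classifying the Lucas strings of length \<open>n\<close> by their
  least period gives \<open>L n = (\<Sum>d | d dvd n. p d)\<close>. For \<open>f\<close> of least period \<open>d\<close>, the \<open>k < n\<close> with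
  \<open>f (k - i) = f i\<close> for all \<open>i\<close> form a single residue class modulo \<open>d\<close> if there is one at all, and
  for \<open>d = n\<close> there is one iff the string is symmetric. Counting the pairs of a Lucas string and a
  reflection fixing it in two ways gives
  \<open>n * fib (n div 2 + 2) = (\<Sum>d | d dvd n. (n div d) * s d)\<close>. Both identities are inverted with
  the Moebius function. Finally, a string is asymmetric iff it is primitive and not symmetric.
\<close>

section \<open>Periodic functions on the integers\<close>

text \<open>The shift \<open>d\<close> may be zero or negative, so the periods of \<open>f\<close>
  form a subgroup of the integers.\<close>

definition period :: "(int \<Rightarrow> bool) \<Rightarrow> int \<Rightarrow> bool"
  where "period f d \<longleftrightarrow> (\<forall>i. f (i + d) = f i)"

definition least_period :: "(int \<Rightarrow> bool) \<Rightarrow> nat"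
  where "least_period f = (LEAST d. 0 < d \<and> period f (int d))"

definition sparse :: "(int \<Rightarrow> bool) \<Rightarrow> bool"
  where "sparse f \<longleftrightarrow> (\<forall>i. \<not> (f i \<and> f (i + 1)))"

text \<open>The reflection has centre \<open>k / 2\<close>: an even \<open>k\<close> fixes an
  integer position, an odd \<open>k\<close> exchanges two adjacent ones.\<close>

definition reflective :: "(int \<Rightarrow> bool) \<Rightarrow> int \<Rightarrow> bool"
  where "reflective f k \<longleftrightarrow> (\<forall>i. f (k - i) = f i)"

text \<open>The period \<open>n\<close> is not required to be minimal: \<open>lucas_funs n\<close> is the disjoint union, over the
  divisors \<open>d\<close> of \<open>n\<close>, of the functions in \<open>lucas_funs d\<close> with least period \<open>d\<close>.\<close>

definition lucas_funs :: "nat \<Rightarrow> (int \<Rightarrow> bool) set"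
  where "lucas_funs n = {f. period f (int n) \<and> sparse f}"

lemma period_add: "period f a \<Longrightarrow> period f b \<Longrightarrow> period f (a + b)"
  by (simp add: period_def flip: add.assoc)

lemma period_minus: "period f a \<Longrightarrow> period f (- a)"
  unfolding period_def by (metis add.commute add_diff_cancel uminus_add_conv_diff)

lemma period_mult: 
  assumes "period f a" shows "period f (k * a)"
proof -
  have nat: "period f (int m * a)" for m
  proof (induction m)
    case 0 show ?case by (simp add: period_def)
  next
    case (Suc m) then show ?case using period_add[OF assms Suc] by (simp add: algebra_simps)
  qed
  show ?thesis
  proof (cases "k \<ge> 0")
    case True then show ?thesis using nat[of "nat k"] by simp
  next
    case False then show ?thesis using period_minus[OF nat[of "nat (- k)"]] by simp
  qed
qed

lemma period_dvd: "period f a \<Longrightarrow> a dvd b \<Longrightarrow> period f b"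
  by (metis dvdE mult.commute period_mult)

lemma period_cong:
  assumes "period f d" "i mod d = j mod d" shows "f i = f j"
proof -
  have "period f (i - j)" using assms by (simp add: period_dvd mod_eq_dvd_iff)
  then have "f (j + (i - j)) = f j" unfolding period_def by blast
  then show ?thesis by simp
qed

lemma least_period:
  assumes "period f (int n)" "n > 0"
  shows least_period_pos: "least_period f > 0" and period_least_period: "period f (int (least_period f))"
  using LeastI[of "\<lambda>d. 0 < d \<and> period f (int d)" n] assms by (auto simp: least_period_def)

text \<open>Division with remainder: if \<open>k\<close> is a period, then so is its remainder
  modulo the least period, and minimality forces this remainder to be 0.\<close>

lemma period_iff_least_period_dvd:
  assumes "period f (int n)" "n > 0"
  shows "period f k \<longleftrightarrow> int (least_period f) dvd k"
proof
  let ?d = "least_period f"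
  note d = least_period[OF assms]
  assume k: "period f k"
  have "k mod int ?d = k + (- (k div int ?d)) * int ?d"
    by (simp add: minus_div_mult_eq_mod[symmetric])
  then have r: "period f (k mod int ?d)"
    using period_add[OF k period_mult[OF d(2), of "- (k div int ?d)"]] by simp
  show "int ?d dvd k"
  proof (rule ccontr)
    assume "\<not> int ?d dvd k"
    then have "k mod int ?d > 0" using d(1)
      by (metis dvd_eq_mod_eq_0 of_nat_0_less_iff pos_mod_sign zero_le_imp_eq_int order_le_less)
    moreover have "nat (k mod int ?d) < ?d" using d(1) by (simp add: nat_less_iff)
    ultimately show False
      using not_less_Least[of "nat (k mod int ?d)" "\<lambda>d. 0 < d \<and> period f (int d)"] r
      by (simp add: least_period_def)
  qed
qed (rule period_dvd[OF period_least_period[OF assms]])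

section \<open>Counting the reflections that fix a given function\<close>

lemma card_residue_class:
  fixes d n :: nat and a :: int
  assumes "d dvd n" "d > 0"
  shows "card {k \<in> {..<n}. int d dvd int k - a} = n div d"
proof -
  define r where "r = nat (a mod int d)"
  have r: "r < d" "int r = a mod int d" using assms by (auto simp: r_def nat_less_iff)
  have iff: "int d dvd int k - a \<longleftrightarrow> k mod d = r" for k
  proof -
    have "int d dvd int k - a \<longleftrightarrow> int k mod int d = a mod int d" by (simp add: mod_eq_dvd_iff)
    also have "\<dots> \<longleftrightarrow> k mod d = r" using r(2) by (metis nat_int of_nat_mod)
    finally show ?thesis .
  qed
  obtain m where m: "n = d * m" using assms by auto
  have "bij_betw (\<lambda>j. d * j + r) {..<m} {k. k < n \<and> k mod d = r}"
  proof (rule bij_betw_byWitness[where f' = "\<lambda>k. k div d"])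
    show "(\<lambda>j. d * j + r) ` {..<m} \<subseteq> {k. k < n \<and> k mod d = r}"
    proof safe
      fix j assume "j < m"
      then have "d * Suc j \<le> d * m" by (intro mult_le_mono2) simp
      then show "d * j + r < n" using r by (simp add: m)
    qed (use r in simp)
    show "(\<lambda>k. k div d) ` {k. k < n \<and> k mod d = r} \<subseteq> {..<m}"
      using assms by (auto simp: m div_less_iff_less_mult mult.commute)
  qed (use r in auto)
  then have "card {k. k < n \<and> k mod d = r} = m" by (simp add: bij_betw_same_card[symmetric])
  then show ?thesis using assms m by (simp add: iff)
qed

text \<open>Two reflections compose to the translation by the difference of their parameters. The
  reflections fixing \<open>f\<close> thus form a coset of the group of periods, if there are
  any.\<close>

lemma reflective_iff_period:
  assumes "reflective f a" shows "reflective f k \<longleftrightarrow> period f (k - a)"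
proof -
  have "f (k - i) = f (i + (a - k))" for i
    using assms unfolding reflective_def by (metis diff_diff_eq2 diff_add_eq add.commute)
  then have "reflective f k \<longleftrightarrow> period f (a - k)" by (simp add: reflective_def period_def)
  also have "\<dots> \<longleftrightarrow> period f (k - a)" using period_minus[of f "a - k"] period_minus[of f "k - a"] by auto
  finally show ?thesis .
qed

lemma card_reflective:
  assumes "period f (int n)" "n > 0"
  shows "card {k \<in> {..<n}. reflective f (int k)} =
    (if \<exists>k. reflective f k then n div least_period f else 0)"
proof (cases "\<exists>k. reflective f k")
  case True
  then obtain a where "reflective f a" by blast
  then have "card {k \<in> {..<n}. reflective f (int k)} = card {k \<in> {..<n}. int (least_period f) dvd int k - a}"
    by (simp add: reflective_iff_period[of f a] period_iff_least_period_dvd[OF assms])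
  also have "\<dots> = n div least_period f"
    using assms period_iff_least_period_dvd[OF assms, of "int n"] least_period_pos[OF assms]
    by (intro card_residue_class) auto
  finally show ?thesis using True by simp
qed auto

section \<open>Lucas functions sorted by least period\<close>

lemma least_period_dvd:
  assumes "f \<in> lucas_funs n" "n > 0" shows "least_period f dvd n"
  using assms period_iff_least_period_dvd[of f n "int n"] by (auto simp: lucas_funs_def)

lemma lucas_funs_filter_least_period:
  assumes "d dvd n" "n > 0"
  shows "{f \<in> lucas_funs n. least_period f = d} = {f \<in> lucas_funs d. least_period f = d}"
  using assms period_least_period[of _ n] period_dvd[of _ "int d" "int n"] by (auto simp: lucas_funs_def)

lemma sum_lucas_funs_by_least_period:
  fixes g :: "(int \<Rightarrow> bool) \<Rightarrow> nat"
  assumes "n > 0" "finite (lucas_funs n)"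
  shows "sum g (lucas_funs n) = (\<Sum>d | d dvd n. sum g {f \<in> lucas_funs d. least_period f = d})"
proof -
  have "sum g (lucas_funs n) = (\<Sum>d | d dvd n. sum g {f \<in> lucas_funs n. least_period f = d})"
    by (rule sum.group[symmetric]) (use assms least_period_dvd in auto)
  also have "\<dots> = (\<Sum>d | d dvd n. sum g {f \<in> lucas_funs d. least_period f = d})"
    by (rule sum.cong) (use assms lucas_funs_filter_least_period in auto)
  finally show ?thesis .
qed

text \<open>The pairs of a function and a reflection \<open>k < n\<close> fixing it are counted
  function by function: least period \<open>d\<close> contributes \<open>n div d\<close> reflections
  or none, by \<open>card_reflective\<close>.\<close>

lemma sum_card_reflective:
  assumes "n > 0" "finite (lucas_funs n)"
  shows "(\<Sum>k<n. card {f \<in> lucas_funs n. reflective f (int k)}) =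
    (\<Sum>d | d dvd n. (n div d) * card {f \<in> lucas_funs d. least_period f = d \<and> (\<exists>k. reflective f k)})"
proof -
  have "(\<Sum>k<n. card {f \<in> lucas_funs n. reflective f (int k)}) = 
    (\<Sum>k<n. \<Sum>f\<in>lucas_funs n. of_bool (reflective f (int k)))"
    using assms by (simp add: sum_of_bool_eq Int_def)
  also have "\<dots> = (\<Sum>f\<in>lucas_funs n. \<Sum>k<n. of_bool (reflective f (int k)))"
    by (rule sum.swap)
  also have "\<dots> = (\<Sum>f\<in>lucas_funs n. card {k \<in> {..<n}. reflective f (int k)})"
    by (simp add: sum_of_bool_eq Int_def)
  also have "\<dots> = (\<Sum>f\<in>lucas_funs n. if \<exists>k. reflective f k then n div least_period f else 0)"
    using assms by (intro sum.cong refl card_reflective) (auto simp: lucas_funs_def)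
  also have "\<dots> = (\<Sum>d | d dvd n. \<Sum>f | f \<in> lucas_funs d \<and> least_period f = d. 
      if \<exists>k. reflective f k then n div least_period f else 0)"
    using sum_lucas_funs_by_least_period[OF assms] by simp
  also have "\<dots> = (\<Sum>d | d dvd n. (n div d) * card {f \<in> lucas_funs d. least_period f = d \<and> (\<exists>k. reflective f k)})"
  proof (intro sum.cong refl)
    fix d assume d: "d \<in> {d. d dvd n}"
    then have fin: "finite {f \<in> lucas_funs d. least_period f = d}"
      using assms lucas_funs_filter_least_period[of d n] by (auto intro: finite_subset[of _ "lucas_funs n"])
    have "(\<Sum>f | f \<in> lucas_funs d \<and> least_period f = d. if \<exists>k. reflective f k then n div least_period f else 0)
      = (\<Sum>f | f \<in> lucas_funs d \<and> least_period f = d. if \<exists>k. reflective f k then n div d else 0)"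
      by (intro sum.cong) auto
    also have "\<dots> = (n div d) * card {f \<in> lucas_funs d. least_period f = d \<and> (\<exists>k. reflective f k)}"
      using fin by (simp add: sum.If_cases Int_def conj_assoc)
    finally show "(\<Sum>f | f \<in> lucas_funs d \<and> least_period f = d. if \<exists>k. reflective f k then n div least_period f else 0)
      = (n div d) * card {f \<in> lucas_funs d. least_period f = d \<and> (\<exists>k. reflective f k)}" .
  qed
  finally show ?thesis .
qed

section \<open>Windows\<close>

text \<open>These are the linear binary words of length \<open>m\<close> without two consecutive 1s,
  placed at position \<open>a\<close> and extended by zeros. The extension lets
  \<open>sparse\<close> be reused without a boundary condition.\<close>

definition sparse_on :: "int \<Rightarrow> nat \<Rightarrow> (int \<Rightarrow> bool) set"
  where "sparse_on a m = {g. sparse g \<and> (\<forall>i. g i \<longrightarrow> a \<le> i \<and> i < a + int m)}"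

lemma sparse_on_Suc_not_last: "{g \<in> sparse_on a (Suc m). \<not> g (a + int m)} = sparse_on a m"
proof -
  have "i < a + int (Suc m) \<longleftrightarrow> i < a + int m \<or> i = a + int m" for i by auto
  then show ?thesis unfolding sparse_on_def by auto
qed

lemma sparse_on_Suc_not_first: "{g \<in> sparse_on a (Suc m). \<not> g a} = sparse_on (a + 1) m"
proof -
  have "a \<le> i \<longleftrightarrow> a + 1 \<le> i \<or> i = a" "i < a + int (Suc m) \<longleftrightarrow> i < a + 1 + int m" for i by auto
  then show ?thesis unfolding sparse_on_def by auto
qed

lemma card_sparse_on: "finite (sparse_on a m) \<and> card (sparse_on a m) = fib (m + 2)"
proof (induction m rule: fib.induct)
  case 1
  have "sparse_on a 0 = {\<lambda>_. False}" by (auto simp: sparse_on_def sparse_def) fastforce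
  then show ?case by simp
next
  case 2
  have "g = (\<lambda>_. False) \<or> g = (\<lambda>i. i = a)" if "\<And>i. g i \<Longrightarrow> a \<le> i \<and> i < a + 1" for g
  proof (cases "g a")
    case True
    then have "g = (\<lambda>i. i = a)" using that by (intro ext) force
    then show ?thesis ..
  next
    case False
    then have "g = (\<lambda>_. False)" using that by (intro ext) force
    then show ?thesis ..
  qed
  then have "sparse_on a (Suc 0) = {\<lambda>_. False, \<lambda>i. i = a}"
    by (auto simp: sparse_on_def sparse_def)
  moreover have "(\<lambda>_. False) \<noteq> (\<lambda>i. i = a)" by (auto dest: fun_cong)
  ultimately show ?case by (simp add: numeral_eq_Suc)
next
  case (3 m)
  let ?t = "a + int m + 1"
  define B where "B = {g \<in> sparse_on a (Suc (Suc m)). g ?t}"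
  have zero: "{g \<in> sparse_on a (Suc (Suc m)). \<not> g ?t} = sparse_on a (Suc m)"
    using sparse_on_Suc_not_last[of a "Suc m"] by (simp add: algebra_simps)
  have "bij_betw (\<lambda>g. g(?t := True)) (sparse_on a m) {g \<in> sparse_on a (Suc (Suc m)). g ?t}"
  proof (rule bij_betw_byWitness[where f' = "\<lambda>g. g(?t := False)"])
    show "\<forall>g\<in>sparse_on a m. (g(?t := True))(?t := False) = g"
      by (auto simp: sparse_on_def fun_eq_iff)
    show "(\<lambda>g. g(?t := True)) ` sparse_on a m \<subseteq> {g \<in> sparse_on a (Suc (Suc m)). g ?t}"
      by (fastforce simp: sparse_on_def sparse_def)
    show "(\<lambda>g. g(?t := False)) ` {g \<in> sparse_on a (Suc (Suc m)). g ?t} \<subseteq> sparse_on a m"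
    proof safe
      fix g assume g: "g \<in> sparse_on a (Suc (Suc m))" "g ?t"
      \<comment> \<open>The position before the final 1 is 0, so erasing that 1 leaves a support
        within the first \<open>m\<close> positions.\<close>
      then have "\<not> g (a + int m)" by (auto simp: sparse_on_def sparse_def)
      then show "g(?t := False) \<in> sparse_on a m"
        using g by (auto simp: sparse_on_def sparse_def) (smt (verit))+
    qed
    show "\<forall>g\<in>{g \<in> sparse_on a (Suc (Suc m)). g ?t}. (g(?t := False))(?t := True) = g"
      by (auto simp: fun_eq_iff)
  qed
  then have bij: "bij_betw (\<lambda>g. g(?t := True)) (sparse_on a m) B" by (simp add: B_def)
  have B: "finite B" "card B = fib (m + 2)"
    using 3 bij_betw_finite[OF bij] bij_betw_same_card[OF bij] by simp_all
  have split: "sparse_on a (Suc (Suc m)) = sparse_on a (Suc m) \<union> B"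
    using zero by (auto simp: B_def)
  have "sparse_on a (Suc m) \<inter> B = {}"
    by (auto simp: sparse_on_def B_def)
  then show ?case
    unfolding split using 3 B by (simp add: card_Un_disjoint)
qed

section \<open>Reflections of sparse periodic functions\<close>

text \<open>Functions invariant under a group acting on the integers are determined by their values on a
  fundamental domain \<open>W\<close>, onto which \<open>\<phi>\<close> folds the integers.\<close>

lemma card_fold_eq:
  fixes \<phi> :: "int \<Rightarrow> int"
  assumes "\<And>f i. f \<in> S \<Longrightarrow> f (\<phi> i) = f i"
    and "\<And>f i. f \<in> S \<Longrightarrow> f (\<phi> i) \<Longrightarrow> \<phi> i \<in> W"
    and "\<And>g i. g \<in> T \<Longrightarrow> g i \<Longrightarrow> i \<in> W"
    and "\<And>i. i \<in> W \<Longrightarrow> \<phi> i = i"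
    and "\<And>f. f \<in> S \<Longrightarrow> (\<lambda>i. i \<in> W \<and> f i) \<in> T"
    and "\<And>g. g \<in> T \<Longrightarrow> (\<lambda>i. g (\<phi> i)) \<in> S"
  shows "card S = card T"
proof -
  have "bij_betw (\<lambda>f i. i \<in> W \<and> f i) S T"
  proof (rule bij_betw_byWitness[where f' = "\<lambda>g i. g (\<phi> i)"])
    show "\<forall>f\<in>S. (\<lambda>i. \<phi> i \<in> W \<and> f (\<phi> i)) = f"
    proof (intro ballI ext)
      fix f i assume "f \<in> S"
      then show "(\<phi> i \<in> W \<and> f (\<phi> i)) = f i" using assms(1)[of f i] assms(2)[of f i] by argo
    qed
    show "\<forall>g\<in>T. (\<lambda>i. i \<in> W \<and> g (\<phi> i)) = g"
    proof (intro ballI ext)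
      fix g i assume "g \<in> T"
      then show "(i \<in> W \<and> g (\<phi> i)) = g i" using assms(3)[of g i] assms(4)[of i] by auto
    qed
    show "(\<lambda>f i. i \<in> W \<and> f i) ` S \<subseteq> T" using assms(5) by blast
    show "(\<lambda>g i. g (\<phi> i)) ` T \<subseteq> S" using assms(6) by blast
  qed
  then show ?thesis by (rule bij_betw_same_card)
qed

lemma sparse_on_restrict:
  "sparse f \<Longrightarrow> (\<lambda>i. i \<in> {a..<a + int m} \<and> f i) \<in> sparse_on a m"
  unfolding sparse_on_def sparse_def by simp

lemma mod_add_one:
  fixes n :: int assumes "n > 0"
  shows "(i + 1) mod n = (if i mod n = n - 1 then 0 else i mod n + 1)"
proof -
  have eq: "(i + 1) mod n = (i mod n + 1) mod n" by (simp add: mod_add_left_eq)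
  have "0 \<le> i mod n" "i mod n < n" using assms by simp_all
  then have "(i mod n + 1) mod n = i mod n + 1" if "i mod n \<noteq> n - 1"
    using that by (intro mod_pos_pos_trivial) linarith+
  then show ?thesis using eq by auto
qed

lemma lucas_funs_fold_eq:
  assumes "f \<in> lucas_funs n" "reflective f k" "a mod int n = i mod int n \<or> a mod int n = (k - i) mod int n"
  shows "f a = f i"
proof -
  have "f (k - i) = f i" using assms(2) unfolding reflective_def by blast
  moreover have "period f (int n)" using assms(1) by (simp add: lucas_funs_def)
  ultimately show ?thesis using assms(3) period_cong by blast
qed

text \<open>Here \<open>\<phi>\<close> chooses one representative of \<open>i\<close> and
  \<open>k - i\<close> modulo \<open>n\<close>. By \<open>step\<close>, neighbours are sent to
  neighbours or to a common position outside the window, where \<open>g\<close> vanishes; hence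
  folding preserves sparsity. By \<open>outside\<close>, no 1 of \<open>f\<close> is lost by
  restricting it to the window.\<close>

lemma card_reflective_fold:
  fixes \<phi> :: "int \<Rightarrow> int" and a k :: int
  assumes per: "\<And>i. \<phi> (i + int n) = \<phi> i" and refl: "\<And>i. \<phi> (k - i) = \<phi> i"
    and mod: "\<And>i. \<phi> i mod int n = i mod int n \<or> \<phi> i mod int n = (k - i) mod int n"
    and step: "\<And>i. \<phi> (i + 1) = \<phi> i + 1 \<or> \<phi> i = \<phi> (i + 1) + 1 \<or> \<phi> (i + 1) = \<phi> i \<and> \<phi> i \<notin> {a..<a + int m}"
    and outside: "\<And>f i. f \<in> lucas_funs n \<Longrightarrow> reflective f k \<Longrightarrow> f (\<phi> i) \<Longrightarrow> \<phi> i \<in> {a..<a + int m}"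
    and id: "\<And>i. i \<in> {a..<a + int m} \<Longrightarrow> \<phi> i = i"
  shows "card {f \<in> lucas_funs n. reflective f k} = fib (m + 2)"
proof -
  have "card {f \<in> lucas_funs n. reflective f k} = card (sparse_on a m)"
  proof (rule card_fold_eq[where \<phi> = \<phi> and W = "{a..<a + int m}"])
    show "(\<lambda>i. g (\<phi> i)) \<in> {f \<in> lucas_funs n. reflective f k}" if g: "g \<in> sparse_on a m" for g
    proof -
      have "\<not> (g (\<phi> i) \<and> g (\<phi> (i + 1)))" for i
        using step[of i] g by (fastforce simp: sparse_on_def sparse_def)
      then show ?thesis using per refl
        by (simp add: lucas_funs_def sparse_def reflective_def period_def)
    qed
    show "f (\<phi> i) = f i" if "f \<in> {f \<in> lucas_funs n. reflective f k}" for f i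
      using that mod lucas_funs_fold_eq by blast
    show "(\<lambda>i. i \<in> {a..<a + int m} \<and> f i) \<in> sparse_on a m" if "f \<in> {f \<in> lucas_funs n. reflective f k}" for f
      using that by (intro sparse_on_restrict) (simp add: lucas_funs_def)
  qed (use outside id in \<open>auto simp: sparse_on_def\<close>)
  then show ?thesis by (simp add: card_sparse_on)
qed

text \<open>Modulo \<open>n\<close> the reflection exchanges \<open>j\<close> and
  \<open>j + 1\<close>, so a 1 at \<open>j\<close> would have a 1 next to it.\<close>

lemma reflective_zero_middle:
  assumes "f \<in> lucas_funs n" "reflective f k" "2 * j + 1 = k + int n"
  shows "\<not> f j"
proof
  assume "f j"
  have "f (j + 1) = f (k - j + int n)" by (simp add: algebra_simps flip: assms(3))
  also have "\<dots> = f j" using assms(1,2) by (simp add: lucas_funs_def period_def reflective_def)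
  finally show False using \<open>f j\<close> assms(1) by (auto simp: lucas_funs_def sparse_def)
qed

text \<open>The window is \<open>{0..n div 2}\<close>. For odd \<open>n\<close> its last position is adjacent to its own mirror
  image, so the function vanishes there.\<close>

lemma card_reflective_0:
  assumes "n > 0"
  shows "card {f \<in> lucas_funs n. reflective f 0} = fib ((if even n then n div 2 + 1 else n div 2) + 2)"
\<comment> \<open>The map \<open>\<phi>\<close> is the distance to the nearest multiple of
  \<open>n\<close>, which represents both \<open>i\<close> and \<open>- i\<close> up to sign modulo
  \<open>n\<close>.\<close>
proof (rule card_reflective_fold[where \<phi> = "\<lambda>i. min (i mod int n) (int n - i mod int n)" and a = 0])
  fix i :: int
  let ?j = "i mod int n"
  have j: "0 \<le> ?j" "?j < int n" using assms by simp_all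
  have neg: "(- i) mod int n = (if ?j = 0 then 0 else int n - ?j)"
    by (simp add: zmod_zminus1_eq_if)
  show "min ((i + int n) mod int n) (int n - (i + int n) mod int n) = min ?j (int n - ?j)" by simp
  show "min ((0 - i) mod int n) (int n - (0 - i) mod int n) = min ?j (int n - ?j)"
    using j by (auto simp: neg)
  show "min ?j (int n - ?j) mod int n = ?j \<or> min ?j (int n - ?j) mod int n = (0 - i) mod int n"
    using j by (auto simp: neg min_def)
  show "min ((i + 1) mod int n) (int n - (i + 1) mod int n) = min ?j (int n - ?j) + 1 \<or>
    min ?j (int n - ?j) = min ((i + 1) mod int n) (int n - (i + 1) mod int n) + 1 \<or>
    min ((i + 1) mod int n) (int n - (i + 1) mod int n) = min ?j (int n - ?j) \<and>
    min ?j (int n - ?j) \<notin> {0..<0 + int (if even n then n div 2 + 1 else n div 2)}"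
    using j assms by (auto simp: mod_add_one elim!: evenE oddE)
  show "min ?j (int n - ?j) = i" if "i \<in> {0..<0 + int (if even n then n div 2 + 1 else n div 2)}"
  proof -
    have "?j = i" using that assms by (auto split: if_splits elim!: evenE oddE)
    then show ?thesis using that by (auto split: if_splits elim!: evenE oddE)
  qed
  fix f assume f: "f \<in> lucas_funs n" "reflective f 0" "f (min ?j (int n - ?j))"
  then have "2 * min ?j (int n - ?j) + 1 \<noteq> int n" using reflective_zero_middle[OF f(1,2)] by auto
  then show "min ?j (int n - ?j) \<in> {0..<0 + int (if even n then n div 2 + 1 else n div 2)}"
    using j by (auto simp: min_def elim!: evenE oddE)
qed

text \<open>The window is \<open>{1..(n + 1) div 2}\<close>, and position 1 is adjacent to its own mirror image 0. For
  even \<open>n\<close> the same holds at the other end, which leaves \<open>n div 2 - 2\<close> free positions; the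
  truncation for \<open>n = 2\<close> is harmless because \<open>fib 1 = fib 2\<close>.\<close>

lemma card_reflective_1:
  assumes "n > 0"
  shows "card {f \<in> lucas_funs n. reflective f 1} = fib ((if even n then n div 2 - 2 else n div 2) + 2)"
\<comment> \<open>Counted from position 1, the mirror images \<open>i\<close> and
  \<open>1 - i\<close> have offsets \<open>j\<close> and \<open>n - 1 - j\<close> modulo
  \<open>n\<close>; \<open>\<phi>\<close> selects the smaller offset. The window starts at 2 because
  position 1 is forced to be 0.\<close>
proof (rule card_reflective_fold[where \<phi> = "\<lambda>i. 1 + min ((i - 1) mod int n) (int n - 1 - (i - 1) mod int n)" and a = 2])
  fix i :: int
  let ?j = "(i - 1) mod int n"
  let ?p = "1 + min ?j (int n - 1 - ?j)"
  have j: "0 \<le> ?j" "?j < int n" using assms by simp_all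
  define w where "w = int (if even n then n div 2 - 2 else n div 2)"
  \<comment> \<open>The length \<open>w\<close> in linear form: \<open>2 * (2 + w) = n\<close> for
    even \<open>n > 2\<close>, \<open>2 * w + 1 = n\<close> for odd \<open>n\<close>, and the
    truncated value 0 for \<open>n = 2\<close>.\<close>
  have w: "w = 0 \<and> (int n = 2 \<or> int n = 4) \<or> 2 * (2 + w) = int n \<or> 2 * w + 1 = int n"
  proof (cases "even n")
    case True
    then obtain b where "n = 2 * b" by auto
    then show ?thesis using assms by (cases "b \<ge> 2") (auto simp: w_def)
  qed (auto simp: w_def elim!: oddE)
  \<comment> \<open>With a variable \<open>j\<close> in place of the remainder, \<open>step\<close>
    and \<open>interior\<close> are statements of linear integer arithmetic.\<close>
  have step: "1 + min (if j = int n - 1 then 0 else j + 1) (int n - 1 - (if j = int n - 1 then 0 else j + 1)) =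
      1 + min j (int n - 1 - j) + 1 \<or>
    1 + min j (int n - 1 - j) =
      1 + min (if j = int n - 1 then 0 else j + 1) (int n - 1 - (if j = int n - 1 then 0 else j + 1)) + 1 \<or>
    1 + min (if j = int n - 1 then 0 else j + 1) (int n - 1 - (if j = int n - 1 then 0 else j + 1)) =
      1 + min j (int n - 1 - j) \<and> 1 + min j (int n - 1 - j) \<notin> {2..<2 + w}"
    if "0 \<le> j" "j < int n" for j
    using that w unfolding min_def atLeastLessThan_iff by presburger
  have interior: "1 + min j (int n - 1 - j) \<in> {2..<2 + w}"
    if "0 \<le> j" "j < int n" "1 + min j (int n - 1 - j) \<noteq> 1" "2 * (1 + min j (int n - 1 - j)) \<noteq> int n" for j
    using that w unfolding min_def atLeastLessThan_iff by presburger
  have neg: "(- i) mod int n = int n - 1 - ?j"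
  proof -
    have "?j = (i - 1) - int n * ((i - 1) div int n)" by (rule minus_mult_div_eq_mod[symmetric])
    then have "- i - (int n - 1 - ?j) = int n * (- 1 - (i - 1) div int n)"
      by (simp add: algebra_simps)
    then have "(- i) mod int n = (int n - 1 - ?j) mod int n"
      unfolding mod_eq_dvd_iff by simp
    then show ?thesis using j by simp
  qed
  show "1 + min ((i + int n - 1) mod int n) (int n - 1 - (i + int n - 1) mod int n) = ?p"
    using mod_add_self2[of "i - 1" "int n"] by (simp add: algebra_simps)
  show "1 + min ((1 - i - 1) mod int n) (int n - 1 - (1 - i - 1) mod int n) = ?p"
    by (auto simp: neg)
  show "?p mod int n = i mod int n \<or> ?p mod int n = (1 - i) mod int n"
  proof (cases "?j \<le> int n - 1 - ?j")
    case True
    then have "?p mod int n = (1 + ?j) mod int n" by simp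
    also have "\<dots> = i mod int n" by (simp add: mod_add_right_eq)
    finally show ?thesis ..
  next
    case False
    then have "?p = 1 + (- i) mod int n" by (simp add: neg)
    then have "?p mod int n = (1 + - i) mod int n" by (simp only: mod_add_right_eq)
    then show ?thesis by simp
  qed
  have suc: "(i + 1 - 1) mod int n = (if ?j = int n - 1 then 0 else ?j + 1)"
    using mod_add_one[of "int n" "i - 1"] assms by simp
  show "1 + min ((i + 1 - 1) mod int n) (int n - 1 - (i + 1 - 1) mod int n) = ?p + 1 \<or>
    ?p = 1 + min ((i + 1 - 1) mod int n) (int n - 1 - (i + 1 - 1) mod int n) + 1 \<or>
    1 + min ((i + 1 - 1) mod int n) (int n - 1 - (i + 1 - 1) mod int n) = ?p \<and>
    ?p \<notin> {2..<2 + int (if even n then n div 2 - 2 else n div 2)}"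
    unfolding suc w_def[symmetric] by (rule step[OF j])
  show "?p = i" if "i \<in> {2..<2 + int (if even n then n div 2 - 2 else n div 2)}"
  proof -
    have i: "2 \<le> i" "i < 2 + w" using that by (simp_all add: w_def)
    then have "?j = i - 1" using w by (intro mod_pos_pos_trivial) auto
    then show ?thesis using i w by auto
  qed
  fix f assume f: "f \<in> lucas_funs n" "reflective f 1" "f ?p"
  have "?p \<noteq> 1"
  proof
    assume "?p = 1"
    moreover have "f (1 - 1) = f 1" using f(2) unfolding reflective_def by blast
    ultimately show False using f by (auto simp: lucas_funs_def sparse_def)
  qed
  moreover have "2 * ?p \<noteq> int n" using reflective_zero_middle[OF f(1,2), of ?p] f(3) by auto
  ultimately show "?p \<in> {2..<2 + int (if even n then n div 2 - 2 else n div 2)}"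
    unfolding w_def[symmetric] by (rule interior[OF j])
qed

text \<open>For odd \<open>n\<close> both counts are \<open>fib (n div 2 + 2)\<close>. For
  \<open>n = 2 * b\<close> the sum is \<open>fib (b + 3) + fib b\<close>, which is
  \<open>fib (b + 2) + fib (b + 1) + fib b = 2 * fib (b + 2)\<close>.\<close>

lemma card_reflective_0_1:
  assumes "n > 0"
  shows "card {f \<in> lucas_funs n. reflective f 0} + card {f \<in> lucas_funs n. reflective f 1} = 2 * fib (n div 2 + 2)"
proof (cases "even n")
  case True
  then obtain l where "n div 2 = Suc l" using assms by (cases "n div 2") auto
  then show ?thesis
    using True by (cases l) (simp_all add: card_reflective_0[OF assms] card_reflective_1[OF assms] add.commute)
qed (simp add: card_reflective_0[OF assms] card_reflective_1[OF assms])

text \<open>Translating a function by one position moves the centre \<open>k / 2\<close> by one,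
  hence \<open>k\<close> by 2.\<close>

lemma card_reflective_shift:
  "card {f \<in> lucas_funs n. reflective f (k + 2)} = card {f \<in> lucas_funs n. reflective f k}"
proof -
  have "bij_betw (\<lambda>f i. f (i + 1)) {f \<in> lucas_funs n. reflective f (k + 2)} {f \<in> lucas_funs n. reflective f k}"
  proof (rule bij_betw_byWitness[where f' = "\<lambda>f i. f (i - 1)"])
    show "(\<lambda>f i. f (i + 1)) ` {f \<in> lucas_funs n. reflective f (k + 2)} \<subseteq> {f \<in> lucas_funs n. reflective f k}"
    proof safe
      fix f assume f: "f \<in> lucas_funs n" "reflective f (k + 2)"
      have "f (i + int n + 1) = f (i + 1)" for i
      proof -
        have "f (i + 1 + int n) = f (i + 1)" using f(1) by (simp add: lucas_funs_def period_def)
        then show ?thesis by (simp add: algebra_simps)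
      qed
      moreover have "\<not> (f (i + 1) \<and> f (i + 1 + 1))" for i
        using f(1) unfolding lucas_funs_def sparse_def by blast
      ultimately show "(\<lambda>i. f (i + 1)) \<in> lucas_funs n" by (simp add: lucas_funs_def sparse_def period_def)
      have "f (k - i + 1) = f (i + 1)" for i
      proof -
        have "f (k + 2 - (i + 1)) = f (i + 1)" using f(2) unfolding reflective_def by blast
        then show ?thesis by (simp add: algebra_simps)
      qed
      then show "reflective (\<lambda>i. f (i + 1)) k" by (simp add: reflective_def)
    qed
    show "(\<lambda>f i. f (i - 1)) ` {f \<in> lucas_funs n. reflective f k} \<subseteq> {f \<in> lucas_funs n. reflective f (k + 2)}"
    proof safe
      fix f assume f: "f \<in> lucas_funs n" "reflective f k"
      have "f (i + int n - 1) = f (i - 1)" for i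
      proof -
        have "f (i - 1 + int n) = f (i - 1)" using f(1) by (simp add: lucas_funs_def period_def)
        then show ?thesis by (simp add: algebra_simps)
      qed
      moreover have "\<not> (f (i - 1) \<and> f (i - 1 + 1))" for i
        using f(1) unfolding lucas_funs_def sparse_def by blast
      ultimately show "(\<lambda>i. f (i - 1)) \<in> lucas_funs n" by (simp add: lucas_funs_def sparse_def period_def)
      have "f (k + 2 - i - 1) = f (i - 1)" for i
      proof -
        have "f (k - (i - 1)) = f (i - 1)" using f(2) unfolding reflective_def by blast
        then show ?thesis by (simp add: algebra_simps)
      qed
      then show "reflective (\<lambda>i. f (i - 1)) (k + 2)" by (simp add: reflective_def)
    qed
  qed auto
  then show ?thesis by (rule bij_betw_same_card)
qed

text \<open>The two parity classes of reflection centres need not have the same number of fixed points, but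
  the numbers for consecutive centres always add up to the same value.\<close>

lemma sum_card_reflective_eq_fib:
  assumes "n > 0"
  shows "(\<Sum>k<n. card {f \<in> lucas_funs n. reflective f (int k)}) = n * fib (n div 2 + 2)"
proof -
  define c where "c k = card {f \<in> lucas_funs n. reflective f (int k)}" for k :: nat
  define F where "F = fib (n div 2 + 2)"
  have "c k + c (Suc k) = 2 * F" for k
  proof (induction k)
    case 0 show ?case using card_reflective_0_1[OF assms] by (simp add: c_def F_def)
  next
    case (Suc k)
    have "c (Suc (Suc k)) = c k" using card_reflective_shift[of n "int k"] by (simp add: c_def add.commute)
    then show ?case using Suc by simp
  qed
  \<comment> \<open>Both sums run over one full period of \<open>c\<close>, since
    \<open>c n = c 0\<close>; they agree, and each is half of the total.\<close>
  then have "(\<Sum>k<n. c k) + (\<Sum>k<n. c (Suc k)) = n * (2 * F)"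
    by (simp flip: sum.distrib)
  moreover have "(\<Sum>k<n. c (Suc k)) = (\<Sum>k<n. c k)"
  proof -
    have "reflective f (int n) \<longleftrightarrow> reflective f 0" if "f \<in> lucas_funs n" for f
    proof -
      have "f (- i + int n) = f (- i)" for i using that unfolding lucas_funs_def period_def by blast
      then show ?thesis by (simp add: reflective_def)
    qed
    then have "{f \<in> lucas_funs n. reflective f (int n)} = {f \<in> lucas_funs n. reflective f (int 0)}" by auto
    then have "c n = c 0" by (simp add: c_def)
    then show ?thesis using sum.lessThan_Suc_shift[of c n] by simp
  qed
  ultimately have "(\<Sum>k<n. c k) = n * F" by simp
  then show ?thesis by (simp only: c_def F_def)
qed

section \<open>Lucas numbers\<close>

lemma lucas_num_Suc: "lucas_num (Suc n) = fib (n + 2) + fib n"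
  by (induction n rule: fib.induct) (simp_all add: numeral_2_eq_2)

text \<open>Restricting to one period turns the functions into linear sparse words whose two ends
  are not both 1, the ends being cyclically adjacent.\<close>

lemma card_lucas_funs:
  assumes "n > 0" shows "card (lucas_funs n) = lucas_num n"
proof -
  define T where "T = {g \<in> sparse_on 0 n. \<not> (g 0 \<and> g (int n - 1))}"
  have "card (lucas_funs n) = card T"
  proof (rule card_fold_eq[where \<phi> = "\<lambda>i. i mod int n" and W = "{0..<0 + int n}"])
    show "f (i mod int n) = f i" if "f \<in> lucas_funs n" for f i
      using that period_cong[of f "int n" "i mod int n" i] by (simp add: lucas_funs_def)
    show "(\<lambda>i. i \<in> {0..<0 + int n} \<and> f i) \<in> T" if "f \<in> lucas_funs n" for f
    proof -
      have f: "sparse f" "f (- 1 + int n) = f (- 1)" using that unfolding lucas_funs_def period_def by blast+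
      then have "\<not> (f (- 1) \<and> f (- 1 + 1))" unfolding sparse_def by blast
      then show ?thesis using f(2) sparse_on_restrict[OF f(1), of 0 n] by (auto simp: T_def)
    qed
    show "(\<lambda>i. g (i mod int n)) \<in> lucas_funs n" if "g \<in> T" for g
    proof -
      have "\<not> (g (i mod int n) \<and> g ((i + 1) mod int n))" for i
        using that assms mod_add_one[of "int n" i]
        by (cases "i mod int n = int n - 1") (auto simp: T_def sparse_on_def sparse_def)
      then show ?thesis by (simp add: lucas_funs_def period_def sparse_def)
    qed
  qed (use assms in \<open>auto simp: T_def sparse_on_def\<close>)
  also have "card T = lucas_num n"
  \<comment> \<open>For \<open>n = 1\<close> the two ends are the same position, so only the zero
    function remains.\<close>
  proof (cases "n = 1")
    case True
    then have "T = sparse_on 0 0" using sparse_on_Suc_not_last[of 0 0] by (simp add: T_def)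
    then show ?thesis using True by (simp add: card_sparse_on)
  next
    case False
    then obtain m where m: "n = Suc (Suc m)" using assms by (cases n; cases "n - 1") auto
    \<comment> \<open>\<open>A\<close> holds the words starting with 0, and \<open>B\<close> those
      starting with 1 and ending with 0.\<close>
    define A B where "A = sparse_on 1 (Suc m)" and "B = sparse_on 0 (Suc m) - sparse_on 1 m"
    have first: "{g \<in> sparse_on 0 (Suc k). \<not> g 0} = sparse_on 1 k" for k
      using sparse_on_Suc_not_first[of 0 k] by simp
    have last: "{g \<in> sparse_on 0 n. \<not> g (int n - 1)} = sparse_on 0 (Suc m)"
      using sparse_on_Suc_not_last[of 0 "Suc m"] by (simp add: m add.commute)
    have "T = A \<union> B"
      unfolding T_def A_def B_def first[symmetric] last[symmetric] by (auto simp flip: m)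
    moreover have "A \<inter> B = {}"
      unfolding A_def B_def first[symmetric] by auto
    moreover have "card B = fib (Suc m + 2) - fib (m + 2)"
    proof -
      have "sparse_on 1 m \<subseteq> sparse_on 0 (Suc m)" unfolding first[symmetric] by auto
      then show ?thesis unfolding B_def by (subst card_Diff_subset) (use card_sparse_on in auto)
    qed
    ultimately have "card T = fib (Suc m + 2) + (fib (Suc m + 2) - fib (m + 2))"
      using card_sparse_on[of 1 "Suc m"] card_sparse_on[of 0 "Suc m"]
      by (simp add: card_Un_disjoint A_def B_def)
    then show ?thesis by (simp add: m lucas_num_Suc)
  qed
  finally show ?thesis .
qed

section \<open>Strings as periodic functions\<close>

text \<open>For the empty string \<open>i mod 0 = i\<close> and the values are unspecified, hence
  the later assumption \<open>u \<noteq> []\<close>.\<close>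

definition cyclic_fun :: "bool list \<Rightarrow> int \<Rightarrow> bool"
  where "cyclic_fun u i = u ! nat (i mod int (length u))"

lemma period_cyclic_fun: "period (cyclic_fun u) (int (length u))"
  by (simp add: period_def cyclic_fun_def)

lemma cyclic_fun_nth: "k < length u \<Longrightarrow> cyclic_fun u (int k) = u ! k"
  by (simp add: cyclic_fun_def)

lemma cyclic_fun_eq_iff:
  assumes "length u = length v" shows "cyclic_fun u = cyclic_fun v \<longleftrightarrow> u = v"
proof
  assume eq: "cyclic_fun u = cyclic_fun v"
  show "u = v"
  proof (rule nth_equalityI[OF assms])
    fix k assume "k < length u"
    then show "u ! k = v ! k" using cyclic_fun_nth[of k u] cyclic_fun_nth[of k v] assms eq by simp
  qed
qed simp

lemma period_funs_eqI:
  assumes "period f (int n)" "period g (int n)" "n > 0" "\<And>k. k < n \<Longrightarrow> f (int k) = g (int k)"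
  shows "f = g"
proof
  fix i
  define k where "k = nat (i mod int n)"
  have k: "k < n" "int k mod int n = i mod int n" using assms(3) by (simp_all add: k_def nat_less_iff)
  then show "f i = g i"
    using period_cong[OF assms(1) k(2)] period_cong[OF assms(2) k(2)] assms(4)[OF k(1)] by simp
qed

lemma ex_cyclic_fun:
  assumes "period f (int n)" "n > 0" shows "\<exists>u. length u = n \<and> cyclic_fun u = f"
proof (intro exI conjI)
  let ?u = "map (\<lambda>k. f (int k)) [0..<n]"
  show "length ?u = n" by simp
  have "period (cyclic_fun ?u) (int n)" using period_cyclic_fun[of ?u] by simp
  then show "cyclic_fun ?u = f"
    by (rule period_funs_eqI[OF _ assms]) (simp add: cyclic_fun_nth)
qed

lemma cyclic_fun_cyc_shift:
  assumes "u \<noteq> []" shows "cyclic_fun (cyc_shift u) = (\<lambda>i. cyclic_fun u (i - 1))"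
proof (rule period_funs_eqI)
  let ?n = "length u"
  have len: "length (cyc_shift u) = ?n" using assms by (simp add: cyc_shift_def)
  show "period (cyclic_fun (cyc_shift u)) (int ?n)" using period_cyclic_fun[of "cyc_shift u"] len by simp
  have "cyclic_fun u (i - 1 + int ?n) = cyclic_fun u (i - 1)" for i
    using period_cyclic_fun[of u] unfolding period_def by blast
  then have per: "cyclic_fun u (i + int ?n - 1) = cyclic_fun u (i - 1)" for i
    by (simp add: algebra_simps)
  then show "period (\<lambda>i. cyclic_fun u (i - 1)) (int ?n)" by (simp add: period_def)
  show "?n > 0" using assms by simp
  fix k assume k: "k < ?n"
  show "cyclic_fun (cyc_shift u) (int k) = cyclic_fun u (int k - 1)"
  proof (cases k)
    case 0
    have "cyclic_fun u (0 - 1) = cyclic_fun u (0 + int ?n - 1)" by (rule per[symmetric])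
    also have "0 + int ?n - 1 = int (?n - 1)" using assms by (cases u) simp_all
    also have "cyclic_fun u (int (?n - 1)) = last u" using assms by (subst cyclic_fun_nth) (simp_all add: last_conv_nth)
    finally show ?thesis using 0 k assms by (subst cyclic_fun_nth) (simp_all add: len cyc_shift_def)
  next
    case (Suc j)
    have "cyclic_fun u (int k - 1) = u ! j" using cyclic_fun_nth[of j u] Suc k by simp
    then show ?thesis using Suc k assms by (subst cyclic_fun_nth) (simp_all add: len cyc_shift_def nth_butlast)
  qed
qed

text \<open>Reversal sends position \<open>i\<close> to \<open>length u - 1 - i\<close>, which is
  \<open>- 1 - i\<close> modulo the length.\<close>

lemma cyclic_fun_rev:
  assumes "u \<noteq> []" shows "cyclic_fun (rev u) = (\<lambda>i. cyclic_fun u (- 1 - i))"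
proof (rule period_funs_eqI)
  let ?n = "length u"
  show "period (cyclic_fun (rev u)) (int ?n)" using period_cyclic_fun[of "rev u"] by simp
  have per: "cyclic_fun u (i + int ?n) = cyclic_fun u i" for i
    using period_cyclic_fun[of u] unfolding period_def by blast
  show "period (\<lambda>i. cyclic_fun u (- 1 - i)) (int ?n)"
  proof (unfold period_def, rule allI)
    fix i show "cyclic_fun u (- 1 - (i + int ?n)) = cyclic_fun u (- 1 - i)"
      using per[of "- 1 - (i + int ?n)"] by simp
  qed
  show "?n > 0" using assms by simp
  fix k assume k: "k < ?n"
  have "cyclic_fun u (- 1 - int k) = cyclic_fun u (- 1 - int k + int ?n)" by (rule per[symmetric])
  also have "- 1 - int k + int ?n = int (?n - Suc k)" using k by (simp add: of_nat_diff)
  also have "cyclic_fun u (int (?n - Suc k)) = u ! (?n - Suc k)"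
    using k by (intro cyclic_fun_nth) simp
  also have "\<dots> = cyclic_fun (rev u) (int k)"
    using k by (subst cyclic_fun_nth) (simp_all add: rev_nth)
  finally show "cyclic_fun (rev u) (int k) = cyclic_fun u (- 1 - int k)" by simp
qed

text \<open>The condition on \<open>hd u\<close> and \<open>last u\<close> is sparsity at the seam,
  where the last position is followed by a copy of the first. In length 1 every position is its own
  neighbour modulo 1, which excludes the string 1.\<close>

lemma lucas_string_iff_sparse:
  assumes "u \<noteq> []" shows "lucas_string u \<longleftrightarrow> sparse (cyclic_fun u)"
proof
  let ?n = "length u"
  have per: "cyclic_fun u (i + int ?n) = cyclic_fun u i" for i
    using period_cyclic_fun[of u] unfolding period_def by blast
  have last: "cyclic_fun u (int (?n - 1)) = last u" and hd: "cyclic_fun u 0 = hd u"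
    using assms cyclic_fun_nth[of "?n - 1" u] cyclic_fun_nth[of 0 u]
    by (simp_all add: last_conv_nth hd_conv_nth)
  show "sparse (cyclic_fun u)" if l: "lucas_string u"
    unfolding sparse_def
  proof
    fix i
    define k where "k = nat (i mod int ?n)"
    have k: "k < ?n" "int k mod int ?n = i mod int ?n" using assms by (simp_all add: k_def nat_less_iff)
    have "int (Suc k) mod int ?n = (i + 1) mod int ?n"
      using k(2) by (metis mod_add_left_eq of_nat_Suc add.commute)
    then have eq: "cyclic_fun u i = cyclic_fun u (int k)" "cyclic_fun u (i + 1) = cyclic_fun u (int (Suc k))"
      using k(2) period_cong[OF period_cyclic_fun[of u]] by metis+
    show "\<not> (cyclic_fun u i \<and> cyclic_fun u (i + 1))"
    proof (cases "Suc k = ?n")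
      case True
      then have "k = ?n - 1" by simp
      then have "cyclic_fun u i = last u" using eq(1) last by simp
      moreover have "cyclic_fun u (i + 1) = hd u" using eq(2) True per[of 0] hd by simp
      ultimately have "cyclic_fun u i = last u" "cyclic_fun u (i + 1) = hd u" by simp_all
      then show ?thesis using l assms by (auto simp: lucas_string_def)
    next
      case False
      then have "Suc k < ?n" using k by simp
      then show ?thesis using l k eq cyclic_fun_nth[of k u] cyclic_fun_nth[of "Suc k" u]
        by (auto simp: lucas_string_def)
    qed
  qed
  show "lucas_string u" if s: "sparse (cyclic_fun u)"
    unfolding lucas_string_def
  proof (intro conjI notI; elim exE conjE)
    fix i assume i: "Suc i < ?n" "u ! i" "u ! Suc i"
    have "\<not> (cyclic_fun u (int i) \<and> cyclic_fun u (int i + 1))" using s unfolding sparse_def by blast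
    moreover have "int i + 1 = int (Suc i)" by simp
    ultimately show False using i cyclic_fun_nth[of i u] cyclic_fun_nth[of "Suc i" u] by simp
  next
    assume "hd u" "last u"
    moreover have "\<not> (cyclic_fun u (int (?n - 1)) \<and> cyclic_fun u (int (?n - 1) + 1))"
      using s unfolding sparse_def by blast
    moreover have "int (?n - 1) + 1 = 0 + int ?n" using assms by (cases u) simp_all
    ultimately show False using last hd per[of 0] by simp
  qed
qed

lemma nth_concat_replicate:
  "i < k * length v \<Longrightarrow> concat (replicate k v) ! i = v ! (i mod length v)"
proof (induction k arbitrary: i)
  case (Suc k)
  show ?case
  proof (cases "i < length v")
    case True then show ?thesis by (simp add: nth_append)
  next
    case False
    then have "i - length v < k * length v" using Suc.prems by auto
    then show ?thesis using False Suc.IH by (simp add: nth_append le_mod_geq)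
  qed
qed simp

text \<open>A least period \<open>d\<close> below the length divides it and makes \<open>u\<close> a
  power of its prefix of length \<open>d\<close>. Conversely, a power of \<open>v\<close> has the
  period \<open>length v\<close>.\<close>

lemma primitive_iff_least_period:
  assumes "u \<noteq> []" shows "primitive u \<longleftrightarrow> least_period (cyclic_fun u) = length u"
proof
  let ?n = "length u" and ?d = "least_period (cyclic_fun u)"
  have n: "?n > 0" using assms by simp
  note d = least_period[OF period_cyclic_fun n]
  have dvd: "?d dvd ?n" using period_iff_least_period_dvd[OF period_cyclic_fun n, of "int ?n"] period_cyclic_fun[of u] by simp
  then obtain k where k: "?n = k * ?d" by (metis dvdE mult.commute)
  show "?d = ?n" if prim: "primitive u"
  proof (rule ccontr)
    assume "?d \<noteq> ?n"
    then have k2: "k \<ge> 2" using k n by (cases k; cases "k - 1") auto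
    have le: "?d \<le> ?n" using dvd n by (simp add: dvd_imp_le)
    have "u = concat (replicate k (take ?d u))"
    proof (rule nth_equalityI)
      show "?n = length (concat (replicate k (take ?d u)))" using k le by (simp add: length_concat sum_list_replicate)
      fix i assume i: "i < ?n"
      have "u ! i = cyclic_fun u (int (i mod ?d))"
        using i cyclic_fun_nth[of i u] period_cong[OF d(2), of "int i" "int (i mod ?d)"] by (simp add: of_nat_mod)
      also have "\<dots> = u ! (i mod ?d)" using d(1) le by (intro cyclic_fun_nth) (meson mod_less_divisor order_less_le_trans)
      also have "\<dots> = take ?d u ! (i mod length (take ?d u))" using le d(1) by (simp add: min_absorb2)
      also have "\<dots> = concat (replicate k (take ?d u)) ! i"
        using i k le by (intro nth_concat_replicate[symmetric]) (simp add: min_absorb2)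
      finally show "u ! i = concat (replicate k (take ?d u)) ! i" .
    qed
    moreover have "take ?d u \<noteq> []" using d(1) assms by simp
    ultimately show False using prim k2 unfolding primitive_def by blast
  qed
  show "primitive u" if eq: "?d = ?n"
    unfolding primitive_def
  proof (intro notI, elim exE conjE)
    fix v k assume v: "v \<noteq> []" "k \<ge> 2" "u = concat (replicate k v)"
    have len: "?n = k * length v" by (simp add: v(3) length_concat sum_list_replicate)
    have "cyclic_fun u = cyclic_fun v"
    proof (rule period_funs_eqI[OF period_cyclic_fun _ n])
      show "period (cyclic_fun v) (int ?n)" by (rule period_dvd[OF period_cyclic_fun]) (simp add: len)
      fix i assume i: "i < ?n"
      then have "cyclic_fun u (int i) = v ! (i mod length v)"
        using nth_concat_replicate[of i k v] len by (simp add: cyclic_fun_nth v(3))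
      then show "cyclic_fun u (int i) = cyclic_fun v (int i)" by (simp add: cyclic_fun_def nat_mod_distrib)
    qed
    then have "?n dvd length v"
      using period_iff_least_period_dvd[OF period_cyclic_fun n, of "int (length v)"] period_cyclic_fun[of v] eq by simp
    then have "?n \<le> length v" using v(1) by (intro dvd_imp_le) auto
    moreover have "2 * length v \<le> ?n" using v(2) len by simp
    moreover have "length v > 0" using v(1) by simp
    ultimately show False by linarith
  qed
qed

text \<open>This transfers each count of Lucas strings to a count of Lucas functions, for any
  property \<open>P\<close> that can be read off the periodic function as \<open>Q\<close>.\<close>

lemma bij_betw_cyclic_fun:
  assumes "n > 0" "\<And>u. length u = n \<Longrightarrow> P u \<longleftrightarrow> Q (cyclic_fun u)"
  shows "bij_betw cyclic_fun {u. length u = n \<and> lucas_string u \<and> P u} {f \<in> lucas_funs n. Q f}"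
proof (rule bij_betwI')
  fix u assume "u \<in> {u. length u = n \<and> lucas_string u \<and> P u}"
  then show "cyclic_fun u \<in> {f \<in> lucas_funs n. Q f}"
    using assms lucas_string_iff_sparse[of u] period_cyclic_fun[of u] by (auto simp: lucas_funs_def)
next
  fix f assume f: "f \<in> {f \<in> lucas_funs n. Q f}"
  then obtain u where "length u = n" "cyclic_fun u = f"
    using ex_cyclic_fun[of f n] assms(1) by (auto simp: lucas_funs_def)
  then show "\<exists>u\<in>{u. length u = n \<and> lucas_string u \<and> P u}. f = cyclic_fun u"
    using f assms lucas_string_iff_sparse[of u] by (intro bexI[of _ u]) (auto simp: lucas_funs_def)
qed (auto simp: cyclic_fun_eq_iff)

section \<open>Dihedral orbits\<close>

text \<open>This is the orbit relation of the infinite dihedral group acting on the integers, which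
  does not mention \<open>n\<close>; on \<open>n\<close>-periodic functions the action factors
  through the finite dihedral group.\<close>

definition dihedral_equiv :: "(int \<Rightarrow> bool) \<Rightarrow> (int \<Rightarrow> bool) \<Rightarrow> bool"
  where "dihedral_equiv f g \<longleftrightarrow> (\<exists>k. g = (\<lambda>i. f (i + k)) \<or> g = (\<lambda>i. f (k - i)))"

lemma dihedral_equiv_refl: "dihedral_equiv f f"
  unfolding dihedral_equiv_def by (rule exI[of _ 0]) simp

lemma dihedral_equiv_sym: assumes "dihedral_equiv f g" shows "dihedral_equiv g f"
proof -
  obtain k where "g = (\<lambda>i. f (i + k)) \<or> g = (\<lambda>i. f (k - i))"
    using assms unfolding dihedral_equiv_def by blast
  then have "f = (\<lambda>i. g (i + (- k))) \<or> f = (\<lambda>i. g (k - i))" by auto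
  then show ?thesis unfolding dihedral_equiv_def by blast
qed

lemma dihedral_equiv_trans:
  assumes "dihedral_equiv f g" "dihedral_equiv g h" shows "dihedral_equiv f h"
proof -
  obtain k l where "g = (\<lambda>i. f (i + k)) \<or> g = (\<lambda>i. f (k - i))" "h = (\<lambda>i. g (i + l)) \<or> h = (\<lambda>i. g (l - i))"
    using assms unfolding dihedral_equiv_def by blast
  then have "h = (\<lambda>i. f (i + (k + l))) \<or> h = (\<lambda>i. f ((k + l) - i)) \<or> h = (\<lambda>i. f ((k - l) - i)) \<or> h = (\<lambda>i. f (i + (k - l)))"
    by (auto simp: algebra_simps)
  then show ?thesis unfolding dihedral_equiv_def by blast
qed

section \<open>String orbits as classes of \<open>dihedral_equiv\<close>\<close>

lemma carrier_dihedral: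
  "carrier (dihedral n) =
    generate (BijGroup (strings n)) {restrict cyc_shift (strings n), restrict rev (strings n)}"
  using dihedral_generators_in_carrier[of n]
  by (simp add: dihedral_def carrier_subgroup_generated Int_absorb1)

lemma carrier_dihedral_subset: "carrier (dihedral n) \<subseteq> Bij (strings n)"
  using group.generate_incl[OF group_BijGroup dihedral_generators_in_carrier[of n]]
  by (simp add: carrier_dihedral BijGroup_def)

lemma dihedral_equiv_generator:
  assumes "g \<in> {restrict cyc_shift (strings n), restrict rev (strings n)}" "length v = n" "n > 0"
  shows "dihedral_equiv (cyclic_fun v) (cyclic_fun (g v))"
proof -
  have v: "v \<noteq> []" using assms by auto
  have "cyclic_fun (cyc_shift v) = (\<lambda>i. cyclic_fun v (i + (- 1)))" using cyclic_fun_cyc_shift[OF v] by simp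
  moreover have "g v = cyc_shift v \<or> g v = rev v" using assms by auto
  ultimately show ?thesis
    using cyclic_fun_rev[OF v] unfolding dihedral_equiv_def by metis
qed

lemma dihedral_equiv_carrier:
  assumes "g \<in> carrier (dihedral n)" "n > 0" "length v = n"
  shows "length (g v) = n \<and> dihedral_equiv (cyclic_fun v) (cyclic_fun (g v))"
proof -
  let ?X = "strings n" and ?gen = "{restrict cyc_shift (strings n), restrict rev (strings n)}"
  have gen: "?gen \<subseteq> Bij ?X" using dihedral_generators_in_carrier[of n] by (simp add: BijGroup_def)
  have "\<forall>v. length v = n \<longrightarrow> dihedral_equiv (cyclic_fun v) (cyclic_fun (g v))"
    using assms(1) unfolding carrier_dihedral
  proof (induction rule: generate.induct)
    case one
    then show ?case by (simp add: BijGroup_def dihedral_equiv_refl)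
  next
    case (incl h)
    then show ?case using dihedral_equiv_generator assms(2) by blast
  next
    case (inv h)
    show ?case
    proof (intro allI impI)
      fix v :: "bool list" assume v: "length v = n"
      \<comment> \<open>For an inverse, the generator \<open>h\<close> is applied to the preimage
        \<open>w\<close> of \<open>v\<close>, and symmetry of the relation reverses the
        direction.\<close>
      define w where "w = inv_into ?X h v"
      have h: "h \<in> Bij ?X" using inv gen by blast
      then have "v \<in> h ` ?X" using v by (simp add: Bij_def bij_betw_def)
      then have w: "w \<in> ?X" "h w = v" unfolding w_def by (rule inv_into_into, rule f_inv_into_f)
      then have "dihedral_equiv (cyclic_fun w) (cyclic_fun v)"
        using dihedral_equiv_generator[OF inv, of w] assms(2) by simp
      moreover have "(inv\<^bsub>BijGroup ?X\<^esub> h) v = w" using v by (simp add: inv_BijGroup[OF h] w_def)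
      ultimately show "dihedral_equiv (cyclic_fun v) (cyclic_fun ((inv\<^bsub>BijGroup ?X\<^esub> h) v))"
        by (simp add: dihedral_equiv_sym)
    qed
  next
    case (eng h1 h2)
    have h: "h1 \<in> Bij ?X" "h2 \<in> Bij ?X"
      using eng.hyps carrier_dihedral_subset[of n] by (auto simp: carrier_dihedral)
    show ?case
    proof (intro allI impI)
      fix v :: "bool list" assume v: "length v = n"
      have "length (h2 v) = n" using h(2) v Bij_imp_funcset by fastforce
      moreover have "(h1 \<otimes>\<^bsub>BijGroup ?X\<^esub> h2) v = h1 (h2 v)"
        using h v by (simp add: BijGroup_def compose_def)
      ultimately show "dihedral_equiv (cyclic_fun v) (cyclic_fun ((h1 \<otimes>\<^bsub>BijGroup ?X\<^esub> h2) v))"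
        using eng.IH v dihedral_equiv_trans by metis
    qed
  qed
  moreover have "length (g v) = n"
    using assms carrier_dihedral_subset[of n] Bij_imp_funcset by fastforce
  ultimately show ?thesis using assms(3) by blast
qed

lemma dihedral_comp_closed:
  assumes "g \<in> carrier (dihedral n)" "h \<in> carrier (dihedral n)"
  shows "\<exists>r\<in>carrier (dihedral n). \<forall>v\<in>strings n. r v = g (h v)"
proof
  show "g \<otimes>\<^bsub>BijGroup (strings n)\<^esub> h \<in> carrier (dihedral n)"
    using assms unfolding carrier_dihedral by (rule generate.eng)
  show "\<forall>v\<in>strings n. (g \<otimes>\<^bsub>BijGroup (strings n)\<^esub> h) v = g (h v)"
    using assms carrier_dihedral_subset[of n] by (auto simp: BijGroup_def compose_def)
qed

lemma funpow_cyc_shift_in_dihedral: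
  "\<exists>g\<in>carrier (dihedral n). \<forall>v\<in>strings n. g v = (cyc_shift ^^ m) v"
proof (induction m)
  case 0
  have "\<one>\<^bsub>BijGroup (strings n)\<^esub> \<in> carrier (dihedral n)" unfolding carrier_dihedral by (rule generate.one)
  then show ?case by (rule bexI[rotated]) (simp add: BijGroup_def)
next
  case (Suc m)
  then obtain g where g: "g \<in> carrier (dihedral n)" "\<forall>v\<in>strings n. g v = (cyc_shift ^^ m) v" by blast
  have "restrict cyc_shift (strings n) \<in> carrier (dihedral n)"
    unfolding carrier_dihedral by (rule generate.incl) simp
  then obtain r where r: "r \<in> carrier (dihedral n)" "\<forall>v\<in>strings n. r v = restrict cyc_shift (strings n) (g v)"
    using dihedral_comp_closed[OF _ g(1)] by blast
  have "g v \<in> strings n" if "v \<in> strings n" for v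
    using g(1) that carrier_dihedral_subset[of n] Bij_imp_funcset by blast
  then show ?case using r g(2) by (intro bexI[OF _ r(1)]) simp
qed

lemma cyclic_fun_funpow_cyc_shift:
  assumes "u \<noteq> []" shows "length ((cyc_shift ^^ m) u) = length u \<and> cyclic_fun ((cyc_shift ^^ m) u) = (\<lambda>i. cyclic_fun u (i - int m))"
proof (induction m)
  case (Suc m)
  have "(cyc_shift ^^ m) u \<noteq> []" using Suc assms by auto
  moreover have "length (cyc_shift v) = length v" for v by (simp add: cyc_shift_def)
  ultimately show ?case using Suc cyclic_fun_cyc_shift[of "(cyc_shift ^^ m) u"]
    by (simp add: diff_diff_eq)
qed simp

text \<open>Since \<open>cyc_shift\<close> replaces the argument \<open>i\<close> by
  \<open>i - 1\<close>, adding \<open>k\<close> takes \<open>- k\<close> shifts, reduced modulo the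
  length to a natural number.\<close>

lemma eq_funpow_cyc_shiftI:
  assumes "u \<noteq> []" "length w = length u" "cyclic_fun w = (\<lambda>i. cyclic_fun u (i + k))"
  shows "w = (cyc_shift ^^ nat ((- k) mod int (length u))) u"
proof -
  let ?m = "nat ((- k) mod int (length u))"
  have m: "int ?m = (- k) mod int (length u)" using assms(1) by simp
  have "cyclic_fun u (i + k) = cyclic_fun u (i - int ?m)" for i
    by (rule period_cong[OF period_cyclic_fun]) (simp only: m mod_diff_right_eq diff_minus_eq_add)
  then have "cyclic_fun w = cyclic_fun ((cyc_shift ^^ ?m) u)"
    using assms cyclic_fun_funpow_cyc_shift[of u ?m] by simp
  then show ?thesis
    using assms cyclic_fun_funpow_cyc_shift[of u ?m] cyclic_fun_eq_iff[of w "(cyc_shift ^^ ?m) u"] by simp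
qed

text \<open>Group elements stay within the class. Conversely, a translation is a power of
  \<open>cyc_shift\<close>, and a reflection is such a power applied after
  \<open>rev\<close>.\<close>

lemma string_orbit_eq:
  assumes "u \<noteq> []"
  shows "string_orbit u = {w. length w = length u \<and> dihedral_equiv (cyclic_fun u) (cyclic_fun w)}"
proof (intro equalityI subsetI)
  fix w assume "w \<in> string_orbit u"
  then obtain g where "g \<in> carrier (dihedral (length u))" "w = g u"
    unfolding string_orbit_def orbit_def by blast
  then show "w \<in> {w. length w = length u \<and> dihedral_equiv (cyclic_fun u) (cyclic_fun w)}"
    using dihedral_equiv_carrier[of g "length u" u] assms by simp
next
  let ?n = "length u"
  fix w assume "w \<in> {w. length w = ?n \<and> dihedral_equiv (cyclic_fun u) (cyclic_fun w)}"
  then obtain k where len: "length w = ?n"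
    and k: "cyclic_fun w = (\<lambda>i. cyclic_fun u (i + k)) \<or> cyclic_fun w = (\<lambda>i. cyclic_fun u (k - i))"
    by (auto simp: dihedral_equiv_def)
  have "\<exists>g\<in>carrier (dihedral ?n). w = g u"
    using k
  proof
    assume "cyclic_fun w = (\<lambda>i. cyclic_fun u (i + k))"
    then obtain m where m: "w = (cyc_shift ^^ m) u" using eq_funpow_cyc_shiftI[OF assms len] by blast
    obtain g where "g \<in> carrier (dihedral ?n)" "\<forall>v\<in>strings ?n. g v = (cyc_shift ^^ m) v"
      using funpow_cyc_shift_in_dihedral by blast
    then show ?thesis using m by (intro bexI[of _ g]) simp_all
  next
    assume w: "cyclic_fun w = (\<lambda>i. cyclic_fun u (k - i))"
    \<comment> \<open>Reversal sends \<open>j\<close> to \<open>- 1 - j\<close>; solving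
      \<open>- 1 - j = k - i\<close> gives \<open>j = i + (- 1 - k)\<close>.\<close>
    have "cyclic_fun (rev u) (i + (- 1 - k)) = cyclic_fun u (k - i)" for i
      using cyclic_fun_rev[OF assms] by simp
    then have "cyclic_fun w = (\<lambda>i. cyclic_fun (rev u) (i + (- 1 - k)))" using w by simp
    then obtain m where m: "w = (cyc_shift ^^ m) (rev u)"
      using eq_funpow_cyc_shiftI[of "rev u" w "- 1 - k"] assms len by auto
    obtain g where g: "g \<in> carrier (dihedral ?n)" "\<forall>v\<in>strings ?n. g v = (cyc_shift ^^ m) v"
      using funpow_cyc_shift_in_dihedral by blast
    have "restrict rev (strings ?n) \<in> carrier (dihedral ?n)"
      unfolding carrier_dihedral by (rule generate.incl) simp
    then obtain r where "r \<in> carrier (dihedral ?n)" "\<forall>v\<in>strings ?n. r v = g (restrict rev (strings ?n) v)"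
      using dihedral_comp_closed[OF g(1)] by blast
    then show ?thesis using g(2) m by (intro bexI[of _ r]) simp_all
  qed
  then show "w \<in> string_orbit u"
    unfolding string_orbit_def orbit_def by blast
qed

text \<open>There is one translate for each residue modulo the least period, and equally many
  reflected translates. The two sets coincide if some reflection fixes \<open>f\<close> and are
  disjoint otherwise.\<close>

lemma card_dihedral_class:
  assumes "period f (int n)" "n > 0"
  shows "card {g. dihedral_equiv f g} = (if \<exists>k. reflective f k then least_period f else 2 * least_period f)"
proof -
  let ?p = "least_period f"
  define R where "R = range (\<lambda>k i. f (i + k))"
  define R' where "R' = range (\<lambda>k i. f (k - i))"
  note p = least_period[OF assms]
  have cls: "{g. dihedral_equiv f g} = R \<union> R'" by (auto simp: dihedral_equiv_def R_def R'_def)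
  have "bij_betw (\<lambda>k i. f (i + k)) {0..<int ?p} R"
  proof (rule bij_betwI')
    fix k l assume kl: "k \<in> {0..<int ?p}" "l \<in> {0..<int ?p}"
    show "(\<lambda>i. f (i + k)) = (\<lambda>i. f (i + l)) \<longleftrightarrow> k = l"
    proof
      assume "(\<lambda>i. f (i + k)) = (\<lambda>i. f (i + l))"
      then have eq: "f (i + k) = f (i + l)" for i by (rule fun_cong)
      have "period f (k - l)"
        unfolding period_def
      proof
        fix i show "f (i + (k - l)) = f i" using eq[of "i - l"] by (simp add: algebra_simps)
      qed
      then have "int ?p dvd k - l" by (simp add: period_iff_least_period_dvd[OF assms])
      then have "k mod int ?p = l mod int ?p" by (simp add: mod_eq_dvd_iff)
      then show "k = l" using kl by simp
    qed simp
  next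
    fix g assume "g \<in> R"
    then obtain k where g: "g = (\<lambda>i. f (i + k))" by (auto simp: R_def)
    have "f (i + k) = f (i + k mod int ?p)" for i
      by (rule period_cong[OF p(2)]) (simp add: mod_add_right_eq)
    then show "\<exists>k\<in>{0..<int ?p}. g = (\<lambda>i. f (i + k))" using p(1) g by (intro bexI[of _ "k mod int ?p"]) simp_all
  qed (auto simp: R_def)
  then have R: "finite R" "card R = ?p" using bij_betw_finite bij_betw_same_card by fastforce+
  have img: "R' = (\<lambda>g i. g (- i)) ` R" by (auto simp: R_def R'_def image_image image_iff)
  have "inj_on (\<lambda>g (i::int). (g (- i) :: bool)) R"
  proof (rule inj_onI)
    fix g h :: "int \<Rightarrow> bool" assume eq: "(\<lambda>i. g (- i)) = (\<lambda>i. h (- i))"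
    show "g = h" using fun_cong[OF eq, of "- i" for i] by (intro ext) simp
  qed
  then have R': "finite R'" "card R' = ?p" using R by (simp_all add: img card_image)
  show "card {g. dihedral_equiv f g} = (if \<exists>k. reflective f k then ?p else 2 * ?p)"
  proof (cases "\<exists>k. reflective f k")
    case True
    then obtain a where a: "\<And>i. f (a - i) = f i" unfolding reflective_def by blast
    have "f (k - i) = f (i + (a - k))" for i k using a[of "k - i"] by (simp add: algebra_simps)
    then have "R' \<subseteq> R" by (auto simp: R_def R'_def)
    then show ?thesis using True R cls by (simp add: Un_absorb2)
  next
    case False
    have "R \<inter> R' = {}"
    proof (rule ccontr)
      assume "R \<inter> R' \<noteq> {}"
      then obtain k l where "(\<lambda>i. f (i + k)) = (\<lambda>i. f (l - i))" by (auto simp: R_def R'_def)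
      then have eq: "f (i + k) = f (l - i)" for i by (rule fun_cong)
      have "f (k + l - i) = f i" for i using eq[of "i - k"] by (simp add: algebra_simps)
      then show False using False by (auto simp: reflective_def)
    qed
    then show ?thesis using False R R' cls by (simp add: card_Un_disjoint)
  qed
qed

lemma card_string_orbit:
  assumes "u \<noteq> []"
  shows "card (string_orbit u) =
    (if \<exists>k. reflective (cyclic_fun u) k then least_period (cyclic_fun u) else 2 * least_period (cyclic_fun u))"
proof -
  let ?n = "length u"
  have n: "?n > 0" using assms by simp
  have "bij_betw cyclic_fun (string_orbit u) {g. dihedral_equiv (cyclic_fun u) g}"
  proof (rule bij_betwI')
    fix g assume "g \<in> {g. dihedral_equiv (cyclic_fun u) g}"
    then obtain k where k: "g = (\<lambda>i. cyclic_fun u (i + k)) \<or> g = (\<lambda>i. cyclic_fun u (k - i))" 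
      and g: "dihedral_equiv (cyclic_fun u) g" by (auto simp: dihedral_equiv_def)
    have per: "cyclic_fun u (i + int ?n) = cyclic_fun u i" for i
      using period_cyclic_fun[of u] unfolding period_def by blast
    have "g (i + int ?n) = g i" for i
      using k per[of "i + k"] per[of "k - (i + int ?n)"] by (auto simp: algebra_simps)
    then have "period g (int ?n)" by (simp add: period_def)
    then obtain w where "length w = ?n" "cyclic_fun w = g" using ex_cyclic_fun n by blast
    then show "\<exists>w\<in>string_orbit u. g = cyclic_fun w" using g by (auto simp: string_orbit_eq[OF assms])
  qed (auto simp: string_orbit_eq[OF assms] cyclic_fun_eq_iff)
  then show ?thesis
    using card_dihedral_class[OF period_cyclic_fun n] by (simp add: bij_betw_same_card)
qed

text \<open>The orbit has \<open>p\<close> or \<open>2 * p\<close> elements, where the least period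
  \<open>p\<close> divides the length. So the size \<open>2 * length u\<close> requires both
  \<open>p = length u\<close> and the absence of a reflection.\<close>

lemma symmetry_iff_reflective:
  assumes "u \<noteq> []"
  shows "asymmetric u \<longleftrightarrow> primitive u \<and> \<not> (\<exists>k. reflective (cyclic_fun u) k)"
    and "primitive u \<Longrightarrow> symmetric u \<longleftrightarrow> (\<exists>k. reflective (cyclic_fun u) k)"
proof -
  have n: "length u > 0" using assms by simp
  have "least_period (cyclic_fun u) dvd length u"
    using period_iff_least_period_dvd[OF period_cyclic_fun n, of "int (length u)"] period_cyclic_fun[of u] by simp
  then have "least_period (cyclic_fun u) \<le> length u" using n by (simp add: dvd_imp_le)
  then show "asymmetric u \<longleftrightarrow> primitive u \<and> \<not> (\<exists>k. reflective (cyclic_fun u) k)"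
    using n by (auto simp: asymmetric_def card_string_orbit[OF assms] primitive_iff_least_period[OF assms])
  show "symmetric u \<longleftrightarrow> (\<exists>k. reflective (cyclic_fun u) k)" if "primitive u"
    using that n by (auto simp: symmetric_def card_string_orbit[OF assms] primitive_iff_least_period[OF assms])
qed

section \<open>Moebius inversion\<close>

lemma moebius_mult_prime:
  assumes "prime p"
  shows "moebius (p * d) = (if p dvd d then 0 else - moebius d)"
proof (cases "p dvd d \<or> d = 0")
  case True
  then have "p ^ 2 dvd p * d" by (auto simp: power2_eq_square)
  then have "\<not> squarefree (p * d)" using assms not_prime_unit[of p] squarefreeD by blast
  then show ?thesis using True by (auto simp: moebius_def)
next
  case False
  then have cop: "coprime p d" using assms by (simp add: prime_imp_coprime)
  then have "squarefree (p * d) \<longleftrightarrow> squarefree d"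
    using squarefree_mult_coprime[OF cop] squarefree_prime[OF assms] squarefree_multD(2) by blast
  moreover have "card (prime_factors (p * d)) = Suc (card (prime_factors d))"
  proof -
    have "prime_factors (p * d) = insert p (prime_factors d)"
      using assms False by (subst prime_factors_product) (auto simp: prime_prime_factors)
    moreover have "p \<notin> prime_factors d" using False by (simp add: in_prime_factors_iff)
    ultimately show ?thesis by simp
  qed
  ultimately show ?thesis using False by (simp add: moebius_def)
qed

text \<open>For a prime \<open>p\<close> dividing \<open>n\<close>, each divisor \<open>d\<close>
  prime to \<open>p\<close> cancels against \<open>p * d\<close>, and the remaining divisors are
  divisible by the square of \<open>p\<close>.\<close>

lemma sum_moebius_divisors:
  assumes "n > 0"
  shows "(\<Sum>d | d dvd n. moebius d) = of_bool (n = 1)"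
proof (cases "n = 1")
  case True
  then show ?thesis by (simp add: moebius_def)
next
  case False
  then obtain p where p: "prime p" "p dvd n" by (metis prime_factor_nat)
  let ?A = "{d. d dvd n \<and> \<not> p dvd d}" and ?B = "{d. d dvd n \<and> p dvd d}"
  have fin: "finite {d. d dvd n}" using assms by simp
  have sub: "(*) p ` ?A \<subseteq> ?B" using p by (auto simp: prime_imp_coprime divides_mult)
  have "(\<Sum>d\<in>?B. moebius d) = (\<Sum>d\<in>(*) p ` ?A. moebius d)"
  proof (rule sum.mono_neutral_right)
    show "\<forall>d\<in>?B - (*) p ` ?A. moebius d = 0"
    proof
      fix d assume d: "d \<in> ?B - (*) p ` ?A"
      then obtain e where e: "d = p * e" by (auto elim: dvdE)
      then have "p dvd e" using d by (auto dest: dvd_mult_right)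
      then show "moebius d = 0" using e p by (simp add: moebius_mult_prime)
    qed
  qed (use fin sub in auto)
  also have "\<dots> = (\<Sum>d\<in>?A. moebius (p * d))"
    using p by (subst sum.reindex) (auto intro!: inj_onI)
  also have "\<dots> = - (\<Sum>d\<in>?A. moebius d)"
    using p by (simp add: moebius_mult_prime sum_negf)
  finally have "(\<Sum>d\<in>?A. moebius d) + (\<Sum>d\<in>?B. moebius d) = 0" by simp
  moreover have "(\<Sum>d | d dvd n. moebius d) = (\<Sum>d\<in>?A. moebius d) + (\<Sum>d\<in>?B. moebius d)"
    using fin by (subst sum.union_disjoint[symmetric]) (auto intro!: sum.cong)
  ultimately show ?thesis using False by simp
qed

text \<open>Stated over a commutative ring to serve both integers and reals. After exchanging the
  sums, the coefficient of \<open>f e\<close> is a Moebius sum over the divisors of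
  \<open>n div e\<close>, which vanishes unless \<open>e = n\<close>.\<close>

lemma moebius_inversion:
  fixes f g :: "nat \<Rightarrow> 'a::comm_ring_1"
  assumes "\<And>n. n > 0 \<Longrightarrow> g n = (\<Sum>d | d dvd n. f d)" and "n > 0"
  shows "f n = (\<Sum>d | d dvd n. of_int (moebius (n div d)) * g d)"
proof -
  have pos: "d > 0" if "d dvd n" for d using that assms(2) by (simp add: dvd_pos_nat)
  have fin: "finite {d. d dvd n}" using assms(2) by simp
  have "(\<Sum>d | d dvd n. of_int (moebius (n div d)) * g d) =
    (\<Sum>d | d dvd n. \<Sum>e | e dvd n \<and> e dvd d. of_int (moebius (n div d)) * f e)"
    using pos assms(1) by (intro sum.cong refl) (auto simp: sum_distrib_left intro!: sum.cong intro: dvd_trans)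
  also have "\<dots> = (\<Sum>e | e dvd n. \<Sum>d | d dvd n \<and> e dvd d. of_int (moebius (n div d)) * f e)"
    using sum.swap_restrict[OF fin fin, of "\<lambda>d e. of_int (moebius (n div d)) * f e" "\<lambda>d e. e dvd d"] by simp
  also have "\<dots> = (\<Sum>e | e dvd n. of_bool (n = e) * f e)"
  proof (intro sum.cong refl)
    fix e assume "e \<in> {e. e dvd n}"
    then obtain m where m: "n = e * m" by (auto elim: dvdE)
    then have em: "e > 0" "m > 0" using assms(2) by auto
    \<comment> \<open>The substitution \<open>t = n div d\<close> maps the \<open>d\<close> between
      \<open>e\<close> and \<open>n\<close> in divisibility order onto the divisors of
      \<open>m\<close>.\<close>
    have "(\<Sum>d | d dvd n \<and> e dvd d. moebius (n div d)) = (\<Sum>t | t dvd m. moebius t)"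
      by (rule sum.reindex_bij_witness[where i = "\<lambda>t. e * (m div t)" and j = "\<lambda>d. n div d"])
        (use em m in \<open>auto elim!: dvdE simp: mult.assoc\<close>)
    also have "\<dots> = of_bool (n = e)" using sum_moebius_divisors[OF em(2)] m em by simp
    finally have "(of_int (\<Sum>d | d dvd n \<and> e dvd d. moebius (n div d)) :: 'a) = of_int (of_bool (n = e))" by simp
    then show "(\<Sum>d | d dvd n \<and> e dvd d. of_int (moebius (n div d)) * f e) = of_bool (n = e) * f e"
      by (simp add: sum_distrib_right[symmetric])
  qed
  also have "\<dots> = (\<Sum>e\<in>{n}. of_bool (n = e) * f e)"
    using fin by (intro sum.mono_neutral_right) auto
  finally show ?thesis by simp
qed

section \<open>Counting Lucas strings\<close>

lemma finite_lucas_funs: "n > 0 \<Longrightarrow> finite (lucas_funs n)"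
  using bij_betw_finite[OF bij_betw_cyclic_fun[of n "\<lambda>_. True" "\<lambda>_. True"]]
    finite_subset[OF _ finite_lists_length_eq[of "UNIV :: bool set" n], of "{u. length u = n \<and> lucas_string u}"]
  by auto

definition num_aperiodic_reflective :: "nat \<Rightarrow> nat"
  where "num_aperiodic_reflective n = card {f \<in> lucas_funs n. least_period f = n \<and> (\<exists>k. reflective f k)}"

lemma num_primitive_eq:
  assumes "n > 0" shows "num_primitive n = card {f \<in> lucas_funs n. least_period f = n}"
  unfolding num_primitive_def
  by (rule bij_betw_same_card, rule bij_betw_cyclic_fun[OF assms]) (use assms primitive_iff_least_period in auto)

lemma num_primitive_symmetric_eq:
  assumes "n > 0" shows "num_primitive_symmetric n = num_aperiodic_reflective n"
  unfolding num_primitive_symmetric_def num_aperiodic_reflective_def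
  by (rule bij_betw_same_card, rule bij_betw_cyclic_fun[OF assms])
    (use assms primitive_iff_least_period symmetry_iff_reflective(2) in auto)

text \<open>The inequality makes the subtraction of natural numbers exact, so that it carries over
  to the integers.\<close>

lemma num_asymmetric_eq:
  assumes "n > 0"
  shows "num_asymmetric n = num_primitive n - num_primitive_symmetric n" "num_primitive_symmetric n \<le> num_primitive n"
proof -
  let ?P = "{u. length u = n \<and> lucas_string u \<and> primitive u}"
  let ?S = "{u. length u = n \<and> lucas_string u \<and> primitive u \<and> symmetric u}"
  have fin: "finite ?P"
    by (rule finite_subset[OF _ finite_lists_length_eq[of UNIV n]]) auto
  have "u \<noteq> []" if "length u = n" for u :: "bool list" using that assms by auto
  then have "{u. length u = n \<and> lucas_string u \<and> asymmetric u} = ?P - ?S"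
    using symmetry_iff_reflective by blast
  moreover have sub: "?S \<subseteq> ?P" by blast
  ultimately show "num_asymmetric n = num_primitive n - num_primitive_symmetric n"
    using fin finite_subset[OF sub fin]
    by (simp add: num_asymmetric_def num_primitive_def num_primitive_symmetric_def card_Diff_subset)
  show "num_primitive_symmetric n \<le> num_primitive n"
    unfolding num_primitive_def num_primitive_symmetric_def by (rule card_mono[OF fin sub])
qed

text \<open>Sorting the Lucas functions of period \<open>m\<close> by least period writes
  \<open>lucas_num m\<close> as a divisor sum, which is then inverted.\<close>

lemma num_primitive_moebius:
  assumes "n > 0"
  shows "int (num_primitive n) = (\<Sum>d | d dvd n. moebius (n div d) * int (lucas_num d))"
proof -
  have "int (lucas_num m) = (\<Sum>d | d dvd m. int (num_primitive d))" if "m > 0" for m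
  proof -
    have "card (lucas_funs m) = (\<Sum>d | d dvd m. card {f \<in> lucas_funs d. least_period f = d})"
      using sum_lucas_funs_by_least_period[OF that finite_lucas_funs[OF that], of "\<lambda>_. 1"] by simp
    also have "\<dots> = (\<Sum>d | d dvd m. num_primitive d)"
      using that by (intro sum.cong refl) (auto simp: num_primitive_eq dvd_pos_nat)
    finally show ?thesis by (simp add: card_lucas_funs that)
  qed
  from moebius_inversion[of "\<lambda>m. int (lucas_num m)", OF this assms] show ?thesis by simp
qed

lemma num_primitive_symmetric_moebius:
  assumes "n > 0"
  shows "int (num_primitive_symmetric n) = int n * (\<Sum>d | d dvd n. moebius (n div d) * int (fib (d div 2 + 2)))"
proof -
  \<comment> \<open>The weight \<open>n div d\<close> in the divisor sum disappears after dividing by \<open>n\<close>.\<close>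
  define s :: "nat \<Rightarrow> real" where "s d = real (num_primitive_symmetric d) / real d" for d
  have "real (fib (m div 2 + 2)) = (\<Sum>d | d dvd m. s d)" if m: "m > 0" for m
  proof -
    have "m * fib (m div 2 + 2) = (\<Sum>d | d dvd m. (m div d) * num_aperiodic_reflective d)"
      using sum_card_reflective[OF m finite_lucas_funs[OF m]] sum_card_reflective_eq_fib[OF m]
      by (simp add: num_aperiodic_reflective_def)
    then have "real m * real (fib (m div 2 + 2)) = (\<Sum>d | d dvd m. real (m div d) * real (num_aperiodic_reflective d))"
      by (simp only: of_nat_mult[symmetric] of_nat_sum[symmetric])
    also have "\<dots> = (\<Sum>d | d dvd m. real m * s d)"
      using m by (intro sum.cong refl)
        (auto simp: s_def num_primitive_symmetric_eq dvd_pos_nat real_of_nat_div)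
    also have "\<dots> = real m * (\<Sum>d | d dvd m. s d)" by (simp add: sum_distrib_left)
    finally show ?thesis using m by simp
  qed
  from moebius_inversion[of "\<lambda>m. real (fib (m div 2 + 2))", OF this assms]
  have "real (num_primitive_symmetric n) =
      real n * (\<Sum>d | d dvd n. of_int (moebius (n div d)) * real (fib (d div 2 + 2)))"
    using assms by (simp add: s_def field_simps)
  then have "real_of_int (int (num_primitive_symmetric n)) =
      real_of_int (int n * (\<Sum>d | d dvd n. moebius (n div d) * int (fib (d div 2 + 2))))"
    by simp
  then show ?thesis by (simp only: of_int_eq_iff)
qed

theorem theorem5p7:
  fixes n :: nat
  assumes "n > 0"
  shows "int (num_primitive n) = (\<Sum>d | d dvd n. moebius (n div d) * int (lucas_num d))
    \<and> int (num_primitive_symmetric n) =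
        int n * (\<Sum>d | d dvd n. moebius (n div d) * int (fib (d div 2 + 2)))
    \<and> int (num_asymmetric n) =
        (\<Sum>d | d dvd n. moebius (n div d) * (int (lucas_num d) - int n * int (fib (d div 2 + 2))))"
proof (intro conjI)
  show p: "int (num_primitive n) = (\<Sum>d | d dvd n. moebius (n div d) * int (lucas_num d))"
    by (rule num_primitive_moebius[OF assms])
  show s: "int (num_primitive_symmetric n) = int n * (\<Sum>d | d dvd n. moebius (n div d) * int (fib (d div 2 + 2)))"
    by (rule num_primitive_symmetric_moebius[OF assms])
  have "int (num_asymmetric n) = int (num_primitive n) - int (num_primitive_symmetric n)"
    using num_asymmetric_eq[OF assms] by (simp add: of_nat_diff)
  then show "int (num_asymmetric n) =
      (\<Sum>d | d dvd n. moebius (n div d) * (int (lucas_num d) - int n * int (fib (d div 2 + 2))))"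
    unfolding p s by (simp add: sum_distrib_left sum_subtractf right_diff_distrib mult.left_commute)
qed

end
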